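(* Let $\Phi=(D,\varphi)$ be a $\mathbb{T}$-gain digraph where $D$ is strongly connected. Then the following are equivalent: (i) $\Phi$ is cycle balanced. (ii) $\Phi\sim(D,\mathbf{1})$, i.e., $\Phi$ has a potential function. (iii) $A(\Phi)$ is cospectral with $A(D)$.
   Context: A digraph $D=(V,\mathcal{A})$ has a finite vertex set $V=\{v_1,\dots,v_n\}$ and a set $\mathcal{A}$ of ordered pairs of distinct vertices, called arcs (no loops; at most one arc from $v_i$ to $v_j$ for each ordered pair; opposite arcs may both be present). A directed cycle is a closed directed walk whose vertices are distinct except that the first and last coincide (so its length is at least $2$; length $2$ is allowed). $D$ is strongly connected if every ordered pair of vertices is joined by a directed path. Let $\mathbb{T}=\{z\in\mathbb{C}:|z|=1\}$. A $\mathbb{T}$-gain digraph is a pair $\Phi=(D,\varphi)$ with $\varphi:\mathcal{A}\to\mathbb{T}$ an arbitrary function (no relation between gains of opposite arcs). Its gain adjacency matrix $A(\Phi)$ has entries $A(\Phi)_{ij}=\varphi(v_i,v_j)$ if $(v_i,v_j)\in\mathcal{A}$ and $0$ otherwise; $A(D)$ is the $0/1$ adjacency matrix of $D$ ($A(D)_{ij}=1$ iff $(v_i,v_j)\in\mathcal{A}$). The gain $\varphi(C)$ of a directed cycle is the product of the gains of its arcs; $\Phi$ is cycle balanced if $\varphi(C)=1$ for every directed cycle $C$ of $D$. For $\sigma:V\to\mathbb{T}$, the switching of $\Phi$ by $\sigma$ is $\Phi^\sigma=(D,\varphi^\sigma)$ with $\varphi^\sigma(v_i,v_j)=\sigma(v_i)\varphi(v_i,v_j)\overline{\sigma(v_j)}$.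 Two $\mathbb{T}$-gain digraphs $\Phi,\Phi'$ on the same $D$ are switching equivalent, $\Phi\sim\Phi'$, if $\Phi'=\Phi^\sigma$ for some $\sigma$. $(D,\mathbf{1})$ denotes $D$ with every arc given gain $1$. A potential function for $\varphi$ is a map $\psi:V\to\mathbb{T}$ with $\varphi(v_i,v_j)=\overline{\psi(v_i)}\,\psi(v_j)$ for every arc $(v_i,v_j)$; its existence means exactly $\Phi\sim(D,\mathbf{1})$. Two matrices are cospectral if they have the same characteristic polynomial. *)

theory Defs
  imports
    "HOL-Library.FuncSet"
    "Graph_Theory.Pair_Digraph"
    "Graph_Theory.Digraph_Component"
    "Jordan_Normal_Form.Char_Poly"
begin

definition unit_circle :: "complex set" where
  "unit_circle = {z. cmod z = 1}"

text \<open>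
  A gain digraph is a digraph \<open>D\<close> together with a gain function \<open>\<phi>\<close>.  Gain functions are total
  on pairs; only their values on the arcs of \<open>D\<close> are meaningful, and every notion below
  inspects only those values.
\<close>

locale gain_digraph = pair_digraph D for D :: "'a pair_pre_digraph" +
  fixes \<phi> :: "'a \<times> 'a \<Rightarrow> complex"
  assumes gain_in_unit_circle: "\<phi> \<in> parcs D \<rightarrow> unit_circle"

definition gain :: "('a \<times> 'a \<Rightarrow> complex) \<Rightarrow> ('a \<times> 'a) awalk \<Rightarrow> complex" where
  "gain \<phi> p = prod_list (map \<phi> p)"

text \<open>
  \<open>pre_digraph.cycle\<close> is the directed cycle, given by its nonempty list of arcs; in a
  loop-free digraph its length is at least 2, and length 2 is allowed.
\<close>

definition cycle_balanced :: "'a pair_pre_digraph \<Rightarrow> ('a \<times> 'a \<Rightarrow> complex) \<Rightarrow> bool" where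
  "cycle_balanced D \<phi> \<longleftrightarrow> (\<forall>C. pre_digraph.cycle (with_proj D) C \<longrightarrow> gain \<phi> C = 1)"

definition switching :: "('a \<Rightarrow> complex) \<Rightarrow> ('a \<times> 'a \<Rightarrow> complex) \<Rightarrow> 'a \<times> 'a \<Rightarrow> complex" where
  "switching \<sigma> \<phi> = (\<lambda>(u, v). \<sigma> u * \<phi> (u, v) * cnj (\<sigma> v))"

definition switching_equivalent ::
  "'a pair_pre_digraph \<Rightarrow> ('a \<times> 'a \<Rightarrow> complex) \<Rightarrow> ('a \<times> 'a \<Rightarrow> complex) \<Rightarrow> bool" where
  "switching_equivalent D \<phi> \<phi>' \<longleftrightarrow>
     (\<exists>\<sigma> \<in> pverts D \<rightarrow> unit_circle. \<forall>a \<in> parcs D. \<phi>' a = switching \<sigma> \<phi> a)"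

definition potential_function ::
  "'a pair_pre_digraph \<Rightarrow> ('a \<times> 'a \<Rightarrow> complex) \<Rightarrow> ('a \<Rightarrow> complex) \<Rightarrow> bool" where
  "potential_function D \<phi> \<psi> \<longleftrightarrow>
     \<psi> \<in> pverts D \<rightarrow> unit_circle \<and> (\<forall>(u, v) \<in> parcs D. \<phi> (u, v) = cnj (\<psi> u) * \<psi> v)"

text \<open>
  The list \<open>vs\<close> is the enumeration of the vertices that indexes rows and columns,
  with indices starting at 0.
\<close>

definition gain_adj_matrix ::
  "'a pair_pre_digraph \<Rightarrow> ('a \<times> 'a \<Rightarrow> complex) \<Rightarrow> 'a list \<Rightarrow> complex mat" where
  "gain_adj_matrix D \<phi> vs = mat (length vs) (length vs)
     (\<lambda>(i, j). if (vs ! i, vs ! j) \<in> parcs D then \<phi> (vs ! i, vs ! j) else 0)"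

definition adj_matrix :: "'a pair_pre_digraph \<Rightarrow> 'a list \<Rightarrow> complex mat" where
  "adj_matrix D vs = mat (length vs) (length vs)
     (\<lambda>(i, j). if (vs ! i, vs ! j) \<in> parcs D then 1 else 0)"

definition cospectral :: "complex mat \<Rightarrow> complex mat \<Rightarrow> bool" where
  "cospectral A B \<longleftrightarrow> char_poly A = char_poly B"

end

theory Submission
  imports Defs "Jordan_Normal_Form.Schur_Decomposition"
begin

text \<open>
  A potential conjugates \<open>A(\<Phi>)\<close> into \<open>A(D)\<close> by a diagonal matrix.  Conversely,
  cospectrality gives \<open>A(\<Phi>)\<^sup>k\<close> and \<open>A(D)\<^sup>k\<close> equal traces for all \<open>k\<close>.  The entries of
  \<open>A(\<Phi>)\<^sup>k\<close> sum the gains of the walks of length \<open>k\<close> counted by \<open>A(D)\<^sup>k\<close>, and these gains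
  have modulus 1, so equality of the traces forces every closed walk to have gain 1.
  From cycle balance, closed walks have gain 1 by splitting off cycles, and in a strongly
  connected digraph the gain of any walk from a fixed root then defines a potential.
\<close>

section \<open>Traces of matrix powers\<close>

definition mat_trace :: "'a :: comm_monoid_add mat \<Rightarrow> 'a" where
  "mat_trace A = (\<Sum>i<dim_row A. A $$ (i, i))"

lemma mat_trace_mult_commute:
  fixes A B :: "'a :: comm_semiring_0 mat"
  assumes "A \<in> carrier_mat n m" "B \<in> carrier_mat m n"
  shows "mat_trace (A * B) = mat_trace (B * A)"
proof -
  have "mat_trace (A * B) = (\<Sum>i<n. \<Sum>j<m. A $$ (i, j) * B $$ (j, i))"
    using assms by (simp add: mat_trace_def scalar_prod_def atLeast0LessThan)
  also have "\<dots> = (\<Sum>j<m. \<Sum>i<n. B $$ (j, i) * A $$ (i, j))"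
    by (subst sum.swap) (simp add: mult.commute)
  also have "\<dots> = mat_trace (B * A)"
    using assms by (simp add: mat_trace_def scalar_prod_def atLeast0LessThan)
  finally show ?thesis .
qed

lemma mat_trace_similar:
  fixes A B :: "'a :: comm_ring_1 mat"
  assumes "similar_mat_wit A B P Q"
  shows "mat_trace A = mat_trace B"
proof -
  obtain n where A: "A \<in> carrier_mat n n" and B: "B \<in> carrier_mat n n"
    and P: "P \<in> carrier_mat n n" and Q: "Q \<in> carrier_mat n n"
    and QP: "Q * P = 1\<^sub>m n" and eq: "A = P * B * Q"
    using similar_mat_witD[OF refl assms] by blast
  have "mat_trace A = mat_trace (P * (B * Q))"
    unfolding eq by (subst assoc_mult_mat[OF P B Q]) (rule refl)
  also have "\<dots> = mat_trace (B * Q * P)"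
    by (rule mat_trace_mult_commute[OF P mult_carrier_mat[OF B Q]])
  also have "B * Q * P = B"
    by (simp only: assoc_mult_mat[OF B Q P] QP right_mult_one_mat[OF B])
  finally show ?thesis .
qed

text \<open>The two claims share one induction because each uses triangularity of the previous
  power. In the sum for entry \<open>(i, j)\<close>, the first factor vanishes for
  \<open>l < i\<close> and the second for \<open>l > j\<close>: nothing survives if
  \<open>j < i\<close>, and only \<open>l = i\<close> survives if \<open>j = i\<close>.\<close>

lemma upper_triangular_pow:
  fixes B :: "'a :: comm_semiring_1 mat"
  assumes "B \<in> carrier_mat n n" "upper_triangular B"
  shows "upper_triangular (B ^\<^sub>m k) \<and> (\<forall>i<n. (B ^\<^sub>m k) $$ (i, i) = (B $$ (i, i)) ^ k)"
proof (induction k)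
  case 0
  then show ?case using assms by auto
next
  case (Suc k)
  have dim: "B ^\<^sub>m k \<in> carrier_mat n n"
    using assms by simp
  have entry: "(B ^\<^sub>m Suc k) $$ (i, j) = (\<Sum>l<n. (B ^\<^sub>m k) $$ (i, l) * B $$ (l, j))"
    if "i < n" "j < n" for i j
    using that assms(1) dim by (simp add: scalar_prod_def atLeast0LessThan)
  have low: "(B ^\<^sub>m k) $$ (i, j) = 0" "B $$ (i, j) = 0" if "j < i" "i < n" for i j
    using Suc assms dim that by (auto simp: upper_triangular_def)
  have "(B ^\<^sub>m Suc k) $$ (i, j) = 0" if "j < i" "i < n" for i j
  proof -
    have "(B ^\<^sub>m k) $$ (i, l) * B $$ (l, j) = 0" if "l < n" for l
      using low \<open>j < i\<close> \<open>i < n\<close> that by (cases "l < i") auto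
    then show ?thesis
      using that by (subst entry) (auto intro!: sum.neutral)
  qed
  moreover have "(B ^\<^sub>m Suc k) $$ (i, i) = (B $$ (i, i)) ^ Suc k" if "i < n" for i
  proof -
    have "(B ^\<^sub>m Suc k) $$ (i, i)
        = (\<Sum>l<n. if l = i then (B ^\<^sub>m k) $$ (i, i) * B $$ (i, i) else 0)"
    proof (subst entry[OF that that], rule sum.cong)
      fix l assume "l \<in> {..<n}"
      then show "(B ^\<^sub>m k) $$ (i, l) * B $$ (l, i)
          = (if l = i then (B ^\<^sub>m k) $$ (i, i) * B $$ (i, i) else 0)"
        using low[of l i] low[of i l] that by (cases l i rule: linorder_cases) auto
    qed simp
    also have "\<dots> = (B $$ (i, i)) ^ Suc k"
      using that Suc by (simp add: mult.commute)
    finally show ?thesis .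
  qed
  ultimately show ?case
    using dim assms(1) by (auto intro!: upper_triangularI simp del: pow_mat.simps)
qed

text \<open>Schur decomposition makes \<open>A\<close> similar to an upper triangular matrix with
  diagonal \<open>es\<close>. Similarity passes to powers and preserves the trace, and powers of a
  triangular matrix have the powers of the diagonal on their diagonal.\<close>

lemma mat_trace_pow_eq_sum_roots:
  fixes A :: "complex mat"
  assumes A: "A \<in> carrier_mat n n"
    and cp: "char_poly A = (\<Prod>a\<leftarrow>es. [:- a, 1:])"
  shows "mat_trace (A ^\<^sub>m k) = (\<Sum>a\<leftarrow>es. a ^ k)"
proof -
  obtain B P Q where "schur_decomposition A es = (B, P, Q)"
    by (cases "schur_decomposition A es")
  from schur_decomposition[OF A cp this] have sim: "similar_mat_wit A B P Q"
    and ut: "upper_triangular B" and es: "diag_mat B = es" by auto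
  have B: "B \<in> carrier_mat n n"
    using similar_mat_witD2[OF A sim] by auto
  have "mat_trace (A ^\<^sub>m k) = mat_trace (B ^\<^sub>m k)"
    by (rule mat_trace_similar[OF similar_mat_wit_pow[OF sim]])
  also have "\<dots> = (\<Sum>i<n. (B $$ (i, i)) ^ k)"
    using upper_triangular_pow[OF B ut, of k] B by (simp add: mat_trace_def)
  also have "\<dots> = (\<Sum>a\<leftarrow>es. a ^ k)"
    using B by (simp add: es[symmetric] diag_mat_def comp_def interv_sum_list_conv_sum_set_nat
        atLeast0LessThan)
  finally show ?thesis .
qed

text \<open>Over the complex numbers the common characteristic polynomial splits, so one list of
  roots gives the power sums for both matrices.\<close>

lemma cospectral_imp_mat_trace_pow_eq:
  assumes "A \<in> carrier_mat n n" "B \<in> carrier_mat n n" "cospectral A B"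
  shows "mat_trace (A ^\<^sub>m k) = mat_trace (B ^\<^sub>m k)"
proof -
  obtain es where "char_poly A = (\<Prod>a\<leftarrow>es. [:- a, 1:])"
    using char_poly_factorized[OF assms(1)] by blast
  moreover from this have "char_poly B = (\<Prod>a\<leftarrow>es. [:- a, 1:])"
    using assms(3) by (simp only: cospectral_def)
  ultimately show ?thesis
    by (simp only: mat_trace_pow_eq_sum_roots[OF assms(1)] mat_trace_pow_eq_sum_roots[OF assms(2)])
qed

section \<open>Entrywise domination of matrix powers\<close>

text \<open>The triangle inequality, applied along the recursion for powers. It is used with a 0/1
  matrix for \<open>R\<close>, whose power entries count the walks whose gains are summed in the
  power of \<open>A\<close>.\<close>

lemma norm_pow_mat_le:
  fixes A :: "'a :: real_normed_field mat" and R :: "real mat"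
  assumes A: "A \<in> carrier_mat n n" and R: "R \<in> carrier_mat n n"
    and le: "\<And>i j. i < n \<Longrightarrow> j < n \<Longrightarrow> norm (A $$ (i, j)) \<le> R $$ (i, j)"
    and "i < n" "j < n"
  shows "norm ((A ^\<^sub>m k) $$ (i, j)) \<le> (R ^\<^sub>m k) $$ (i, j)"
  using assms(4,5)
proof (induction k arbitrary: i j)
  case 0
  then show ?case using A R by simp
next
  case (Suc k)
  have "A ^\<^sub>m k \<in> carrier_mat n n" "R ^\<^sub>m k \<in> carrier_mat n n"
    using A R by simp_all
  then have "norm ((A ^\<^sub>m Suc k) $$ (i, j)) = norm (\<Sum>l<n. (A ^\<^sub>m k) $$ (i, l) * A $$ (l, j))"
    and R_eq: "(R ^\<^sub>m Suc k) $$ (i, j) = (\<Sum>l<n. (R ^\<^sub>m k) $$ (i, l) * R $$ (l, j))"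
    using Suc.prems A R by (simp_all add: scalar_prod_def atLeast0LessThan)
  then have "norm ((A ^\<^sub>m Suc k) $$ (i, j))
      \<le> (\<Sum>l<n. norm ((A ^\<^sub>m k) $$ (i, l) * A $$ (l, j)))"
    by (simp only: norm_sum)
  also have "\<dots> \<le> (\<Sum>l<n. (R ^\<^sub>m k) $$ (i, l) * R $$ (l, j))"
  proof (rule sum_mono)
    fix l assume "l \<in> {..<n}"
    then have "norm ((A ^\<^sub>m k) $$ (i, l)) \<le> (R ^\<^sub>m k) $$ (i, l)"
      and "norm (A $$ (l, j)) \<le> R $$ (l, j)"
      using Suc.IH[of i l] le[of l j] Suc.prems by simp_all
    then show "norm ((A ^\<^sub>m k) $$ (i, l) * A $$ (l, j)) \<le> (R ^\<^sub>m k) $$ (i, l) * R $$ (l, j)"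
      by (simp only: norm_mult) (rule mult_mono'; simp)
  qed
  finally show ?case by (simp only: R_eq)
qed

text \<open>Equality case of the triangle inequality. Each \<open>Re (z i)\<close> is at most
  \<open>r i\<close> and the totals agree, so they agree termwise; the bound on the modulus then
  leaves no room for an imaginary part.\<close>

lemma complex_eq_of_real_if_sum_eq:
  fixes z :: "'i \<Rightarrow> complex" and r :: "'i \<Rightarrow> real"
  assumes "finite I" "\<And>i. i \<in> I \<Longrightarrow> cmod (z i) \<le> r i"
    and "(\<Sum>i\<in>I. z i) = (\<Sum>i\<in>I. of_real (r i))" and "i \<in> I"
  shows "z i = of_real (r i)"
proof -
  have le: "Re (z j) \<le> r j" if "j \<in> I" for j
    using assms(2)[OF that] complex_Re_le_cmod[of "z j"] by linarith
  have "(\<Sum>i\<in>I. Re (z i)) = (\<Sum>i\<in>I. r i)"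
    using arg_cong[OF assms(3), of Re] by simp
  then have re: "Re (z i) = r i"
    using sum_mono_inv[of "\<lambda>i. Re (z i)" I r, OF _ le] assms by blast
  then have "(cmod (z i))\<^sup>2 \<le> (Re (z i))\<^sup>2"
    using assms(2)[OF \<open>i \<in> I\<close>] by (intro power_mono) auto
  then have "Im (z i) = 0"
    by (simp add: cmod_power2)
  then show ?thesis using re by (simp add: complex_eq_iff)
qed

section \<open>Gain digraphs\<close>

lemma gain_Nil [simp]: "gain \<phi> [] = 1"
  and gain_Cons [simp]: "gain \<phi> (e # p) = \<phi> e * gain \<phi> p"
  and gain_append [simp]: "gain \<phi> (p @ q) = gain \<phi> p * gain \<phi> q"
  by (simp_all add: gain_def)

lemma mult_cnj_if_unit_circle:
  assumes "z \<in> unit_circle"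
  shows "z * cnj z = 1" "cnj z * z = 1"
  using assms complex_norm_square[of z] by (simp_all add: unit_circle_def mult.commute)

context gain_digraph
begin

section \<open>Switching, potentials and cycle balance\<close>

lemma cmod_gain_awalk: "awalk u p v \<Longrightarrow> cmod (gain \<phi> p) = 1"
  using gain_in_unit_circle
  by (induction p arbitrary: u) (auto simp: awalk_Cons_iff norm_mult unit_circle_def)

lemma switching_equivalent_one_iff_potential:
  "switching_equivalent D \<phi> (\<lambda>_. 1) \<longleftrightarrow> (\<exists>\<psi>. potential_function D \<phi> \<psi>)"
proof -
  have "1 = switching \<sigma> \<phi> (u, v) \<longleftrightarrow> \<phi> (u, v) = cnj (\<sigma> u) * \<sigma> v"
    if "\<sigma> \<in> pverts D \<rightarrow> unit_circle" "(u, v) \<in> parcs D" for \<sigma> u v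
  proof -
    have u: "\<sigma> u \<in> unit_circle" and v: "\<sigma> v \<in> unit_circle"
      using that wellformed' by auto
    \<comment> \<open>On the unit circle conjugation is inversion, so this factor undoes the
      switching. Being nonzero, it can be cancelled, which gives both directions: a switching
      function to the constant gain 1 is itself a potential.\<close>
    have "cnj (\<sigma> u) * \<sigma> v * switching \<sigma> \<phi> (u, v)
        = (\<sigma> u * cnj (\<sigma> u)) * (\<sigma> v * cnj (\<sigma> v)) * \<phi> (u, v)"
      by (simp add: switching_def mult_ac)
    also have "\<dots> = \<phi> (u, v)"
      using u v by (simp add: mult_cnj_if_unit_circle)
    finally have 1: "cnj (\<sigma> u) * \<sigma> v * switching \<sigma> \<phi> (u, v) = \<phi> (u, v)" .
    have "\<sigma> u \<noteq> 0" "\<sigma> v \<noteq> 0"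
      using u v by (auto simp: unit_circle_def)
    then show ?thesis
      using 1 by (metis complex_cnj_zero_iff mult.right_neutral mult_cancel_left no_zero_divisors)
  qed
  then have "(\<forall>a\<in>parcs D. 1 = switching \<sigma> \<phi> a)
      \<longleftrightarrow> (\<forall>(u, v)\<in>parcs D. \<phi> (u, v) = cnj (\<sigma> u) * \<sigma> v)"
    if "\<sigma> \<in> pverts D \<rightarrow> unit_circle" for \<sigma>
    using that by (intro ball_cong refl) (simp only: split_paired_all prod.case)
  then show ?thesis
    unfolding switching_equivalent_def potential_function_def Bex_def by (intro ex_cong1) blast
qed

text \<open>The product telescopes: at each inner vertex \<open>w\<close> the factors
  \<open>\<psi> w\<close> and \<open>cnj (\<psi> w)\<close> of adjacent arcs cancel. On closed walks
  the two remaining factors cancel as well.\<close>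

lemma gain_awalk_potential:
  assumes "potential_function D \<phi> \<psi>" "awalk u p v"
  shows "gain \<phi> p = cnj (\<psi> u) * \<psi> v"
  using assms(2)
proof (induction p arbitrary: u)
  case Nil
  then have "\<psi> u \<in> unit_circle" "u = v"
    using assms(1) by (auto simp: potential_function_def awalk_Nil_iff)
  then show ?case by (simp add: mult_cnj_if_unit_circle)
next
  case (Cons e p)
  then have e: "e = (u, snd e)" "(u, snd e) \<in> parcs D" and w: "awalk (snd e) p v"
    by (cases e; simp add: awalk_Cons_iff)+
  have "\<phi> e = cnj (\<psi> u) * \<psi> (snd e)" and "\<psi> (snd e) \<in> unit_circle"
    using assms(1) e wellformed' by (auto simp: potential_function_def)
  then show ?case
    using Cons.IH[OF w] mult_cnj_if_unit_circle(1)[of "\<psi> (snd e)"]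
    by (simp add: mult.assoc[of _ "\<psi> (snd e)"] mult.assoc[of "\<psi> (snd e)", symmetric])
qed

lemma potential_imp_cycle_balanced:
  assumes "potential_function D \<phi> \<psi>"
  shows "cycle_balanced D \<phi>"
  unfolding cycle_balanced_def
proof (intro allI impI)
  fix C assume "cycle C"
  then obtain u where u: "awalk u C u" unfolding cycle_def by blast
  then have "\<psi> u \<in> unit_circle"
    using assms by (auto simp: potential_function_def awalk_def)
  then show "gain \<phi> C = 1"
    using gain_awalk_potential[OF assms u] by (simp add: mult_cnj_if_unit_circle)
qed

lemma closed_walk_gain_if_cycle_balanced:
  assumes "cycle_balanced D \<phi>" "awalk u p u"
  shows "gain \<phi> p = 1"
  using assms(2)
proof (induction "length p" arbitrary: u p rule: less_induct)
  case less
  show ?case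
  proof (cases p)
    case Nil
    then show ?thesis by simp
  next
    case (Cons e es)
    show ?thesis
    \<comment> \<open>The tail drops the first vertex, which recurs as the last one; its
      distinctness is what \<open>cycle\<close> demands of a nonempty closed walk.\<close>
    proof (cases "distinct (tl (awalk_verts u p))")
      case True
      then have "cycle p"
        using less.prems Cons by (auto simp: cycle_def)
      then show ?thesis
        using assms(1) by (auto simp: cycle_balanced_def)
    next
      case False
      \<comment> \<open>The vertices of the tail are those of the walk \<open>es\<close>, so the
        repetition yields a nonempty closed subwalk \<open>r\<close> of \<open>es\<close>. Both
        \<open>r\<close> and the remainder \<open>e # q @ s\<close> are strictly shorter than
        \<open>p\<close>: the first omits \<open>e\<close>, the second omits
        \<open>r\<close>.\<close>
      then have "awalk (snd e) es u" "\<not> distinct (awalk_verts (snd e) es)"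
        using less.prems Cons by (auto simp: awalk_Cons_iff)
      from awalk_not_distinct_decomp[OF this] obtain q r s w where es: "es = q @ r @ s"
        and "0 < length r" and w: "awalk (snd e) q w" "awalk w r w" "awalk w s u"
        by blast
      then have "r \<noteq> []" by simp
      have "gain \<phi> r = 1"
        using less.hyps[OF _ w(2)] es Cons by simp
      moreover have "awalk u (e # q @ s) u"
        using w less.prems Cons by (auto simp: awalk_Cons_iff)
      then have "gain \<phi> (e # q @ s) = 1"
        using less.hyps[of "e # q @ s" u] es Cons \<open>r \<noteq> []\<close> by simp
      ultimately show ?thesis
        using Cons es by simp
    qed
  qed
qed

lemma cycle_balanced_imp_potential:
  assumes bal: "cycle_balanced D \<phi>" and sc: "strongly_connected (with_proj D)"
  obtains \<psi> where "potential_function D \<phi> \<psi>"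
proof -
  obtain r where r: "r \<in> pverts D"
    using sc by (auto simp: strongly_connected_def)
  have "\<exists>p. awalk u p v" if "u \<in> pverts D" "v \<in> pverts D" for u v
    using sc that reachable_awalk by (auto simp: strongly_connected_def)
  then obtain W where W: "\<And>u v. u \<in> pverts D \<Longrightarrow> v \<in> pverts D \<Longrightarrow> awalk u (W u v) v"
    by metis
  define \<psi> where "\<psi> v = gain \<phi> (W r v)" for v
  have unit: "\<psi> v \<in> unit_circle" if "v \<in> pverts D" for v
    using cmod_gain_awalk[OF W[OF r that]] by (simp add: \<psi>_def unit_circle_def)
  moreover have "\<phi> (u, v) = cnj (\<psi> u) * \<psi> v" if a: "(u, v) \<in> parcs D" for u v
  proof -
    have uv: "u \<in> pverts D" "v \<in> pverts D" using a wellformed' by auto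
    \<comment> \<open>Two closed walks at the root share the return walk \<open>W v r\<close>; one
      reaches \<open>v\<close> by its chosen walk, the other through \<open>u\<close> and the arc
      \<open>(u, v)\<close>. Comparing their gains determines \<open>\<phi> (u, v)\<close>.\<close>
    have "awalk r (W r v @ W v r) r"
      using W[OF r uv(2)] W[OF uv(2) r] by auto
    from closed_walk_gain_if_cycle_balanced[OF bal this]
    have 1: "\<psi> v * gain \<phi> (W v r) = 1" by (simp add: \<psi>_def)
    have "awalk r (W r u @ (u, v) # W v r) r"
      using W[OF r uv(1)] W[OF uv(2) r] a by (auto simp: awalk_Cons_iff)
    from closed_walk_gain_if_cycle_balanced[OF bal this]
    have 2: "\<psi> u * (\<phi> (u, v) * gain \<phi> (W v r)) = 1" by (simp add: \<psi>_def)
    have "\<phi> (u, v) = (\<psi> u * cnj (\<psi> u)) * (\<psi> v * gain \<phi> (W v r)) * \<phi> (u, v)"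
      by (simp add: 1 mult_cnj_if_unit_circle[OF unit[OF uv(1)]])
    also have "\<dots> = cnj (\<psi> u) * \<psi> v * (\<psi> u * (\<phi> (u, v) * gain \<phi> (W v r)))"
      by (simp only: mult_ac)
    finally show ?thesis
      by (simp only: 2 mult_1_right)
  qed
  ultimately show ?thesis
    by (intro that[of \<psi>]) (auto simp: potential_function_def)
qed

section \<open>Cospectrality and walk counts\<close>

lemma potential_imp_cospectral:
  assumes pot: "potential_function D \<phi> \<psi>" and vs: "set vs \<subseteq> pverts D"
  shows "cospectral (gain_adj_matrix D \<phi> vs) (adj_matrix D vs)"
proof -
  let ?n = "length vs"
  let ?P = "mat_diag ?n (\<lambda>i. cnj (\<psi> (vs ! i)))" and ?Q = "mat_diag ?n (\<lambda>i. \<psi> (vs ! i))"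
  have B: "adj_matrix D vs \<in> carrier_mat ?n ?n"
    by (simp add: adj_matrix_def)
  have unit: "\<psi> (vs ! i) \<in> unit_circle" if "i < ?n" for i
    using pot vs nth_mem[OF that] by (auto simp: potential_function_def)
  have "similar_mat_wit (gain_adj_matrix D \<phi> vs) (adj_matrix D vs) ?P ?Q"
  proof (rule similar_mat_witI)
    show "?P * ?Q = 1\<^sub>m ?n" "?Q * ?P = 1\<^sub>m ?n"
      unfolding mat_diag_diag using unit
      by (auto simp: mat_diag_def mult_cnj_if_unit_circle)
    show "gain_adj_matrix D \<phi> vs = ?P * adj_matrix D vs * ?Q"
      using pot by (subst mat_diag_mult_left[OF B], subst mat_diag_mult_right[of _ ?n])
        (auto simp: gain_adj_matrix_def adj_matrix_def potential_function_def intro!: eq_matI)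
  qed (auto simp: gain_adj_matrix_def adj_matrix_def)
  then show ?thesis
    unfolding cospectral_def by (intro char_poly_similar) (auto simp: similar_mat_def)
qed

text \<open>A real copy of \<open>adj_matrix\<close>, so that entries of its powers can serve as
  upper bounds for norms.\<close>

definition real_adj_matrix :: "'a list \<Rightarrow> real mat" where
  "real_adj_matrix vs = mat (length vs) (length vs)
     (\<lambda>(i, j). if (vs ! i, vs ! j) \<in> parcs D then 1 else 0)"

lemma gain_adj_matrix_carrier: "gain_adj_matrix D \<phi> vs \<in> carrier_mat (length vs) (length vs)"
  and real_adj_matrix_carrier: "real_adj_matrix vs \<in> carrier_mat (length vs) (length vs)"
  by (simp_all add: gain_adj_matrix_def real_adj_matrix_def)

lemma adj_matrix_eq_of_real: "adj_matrix D vs = map_mat of_real (real_adj_matrix vs)"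
  by (auto simp: adj_matrix_def real_adj_matrix_def)

lemma norm_gain_adj_matrix_le:
  assumes "i < length vs" "j < length vs"
  shows "cmod (gain_adj_matrix D \<phi> vs $$ (i, j)) \<le> real_adj_matrix vs $$ (i, j)"
  using assms gain_in_unit_circle
  by (auto simp: gain_adj_matrix_def real_adj_matrix_def unit_circle_def Pi_iff)

text \<open>
  Removing one walk from the sums for both matrices leaves the remaining ones dominated.
\<close>

lemma norm_gain_adj_matrix_pow_diff_le:
  assumes "distinct vs" "set vs = pverts D"
    and "awalk (vs ! i) p (vs ! j)" "i < length vs" "j < length vs"
  shows "cmod ((gain_adj_matrix D \<phi> vs ^\<^sub>m length p) $$ (i, j) - gain \<phi> p)
           \<le> (real_adj_matrix vs ^\<^sub>m length p) $$ (i, j) - 1"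
  using assms(3-)
\<comment> \<open>Arcs are removed at the end of the walk because \<open>A ^\<^sub>m Suc k\<close>
  is \<open>A ^\<^sub>m k * A\<close>.\<close>
proof (induction p arbitrary: j rule: rev_induct)
  case Nil
  then have "i = j"
    using assms(1) by (auto simp: awalk_Nil_iff nth_eq_iff_index_eq)
  then show ?case
    using Nil by (simp add: gain_adj_matrix_def real_adj_matrix_def)
next
  case (snoc e p)
  let ?n = "length vs" and ?A = "gain_adj_matrix D \<phi> vs" and ?R = "real_adj_matrix vs"
  let ?k = "length p"
  obtain w where w: "awalk (vs ! i) p w" "awalk w [e] (vs ! j)"
    using snoc.prems by auto
  then have e: "e = (w, vs ! j)" "(w, vs ! j) \<in> parcs D"
    by (cases e; auto simp: awalk_simps)+
  obtain m where m: "m < ?n" "w = vs ! m"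
    using e(2) wellformed' assms(2) by (metis in_set_conv_nth)
  have Am: "?A $$ (m, j) = \<phi> e" and Rm: "?R $$ (m, j) = 1" and e1: "cmod (\<phi> e) = 1"
    using m e snoc.prems gain_in_unit_circle
    by (auto simp: gain_adj_matrix_def real_adj_matrix_def unit_circle_def)
  have carr: "?A ^\<^sub>m ?k \<in> carrier_mat ?n ?n" "?R ^\<^sub>m ?k \<in> carrier_mat ?n ?n"
    using gain_adj_matrix_carrier real_adj_matrix_carrier by auto
  let ?a = "\<lambda>l. (?A ^\<^sub>m ?k) $$ (i, l) * ?A $$ (l, j)"
  let ?r = "\<lambda>l. (?R ^\<^sub>m ?k) $$ (i, l) * ?R $$ (l, j)"
  \<comment> \<open>The term at \<open>m\<close>, the index of the next-to-last vertex, contains the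
    gain of the chosen walk and is handled by the induction hypothesis; the other terms only need
    entrywise domination.\<close>
  have A_eq: "(?A ^\<^sub>m Suc ?k) $$ (i, j) = ?a m + (\<Sum>l\<in>{..<?n} - {m}. ?a l)"
    and R_eq: "(?R ^\<^sub>m Suc ?k) $$ (i, j) = ?r m + (\<Sum>l\<in>{..<?n} - {m}. ?r l)"
    using carr gain_adj_matrix_carrier[of vs] real_adj_matrix_carrier[of vs] snoc.prems m(1)
    by (simp_all add: scalar_prod_def atLeast0LessThan sum.remove[of _ m])
  have "?a m - gain \<phi> (p @ [e]) = ((?A ^\<^sub>m ?k) $$ (i, m) - gain \<phi> p) * \<phi> e"
    by (simp add: Am algebra_simps)
  then have "cmod (?a m - gain \<phi> (p @ [e])) \<le> ?r m - 1"
    using snoc.IH[of m] w(1) m snoc.prems by (simp add: norm_mult e1 Rm)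
  moreover have "cmod (\<Sum>l\<in>{..<?n} - {m}. ?a l) \<le> (\<Sum>l\<in>{..<?n} - {m}. ?r l)"
  proof (rule order_trans[OF norm_sum], rule sum_mono)
    fix l assume "l \<in> {..<?n} - {m}"
    then have l: "l < ?n" by simp
    have "cmod ((?A ^\<^sub>m ?k) $$ (i, l)) \<le> (?R ^\<^sub>m ?k) $$ (i, l)"
      using norm_pow_mat_le[OF gain_adj_matrix_carrier real_adj_matrix_carrier
          norm_gain_adj_matrix_le] snoc.prems l by blast
    then show "cmod (?a l) \<le> ?r l"
      unfolding norm_mult
      by (rule mult_mono'[OF _ norm_gain_adj_matrix_le[OF l snoc.prems(3)]]) simp_all
  qed
  ultimately have "cmod ((?a m - gain \<phi> (p @ [e])) + (\<Sum>l\<in>{..<?n} - {m}. ?a l))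
      \<le> ?r m - 1 + (\<Sum>l\<in>{..<?n} - {m}. ?r l)"
    by (rule order_trans[OF norm_triangle_ineq add_mono])
  then show ?case
    using A_eq R_eq by (simp add: algebra_simps del: pow_mat.simps)
qed

lemma cospectral_imp_cycle_balanced:
  assumes vs: "distinct vs" "set vs = pverts D"
    and cosp: "cospectral (gain_adj_matrix D \<phi> vs) (adj_matrix D vs)"
  shows "cycle_balanced D \<phi>"
  unfolding cycle_balanced_def
proof (intro allI impI)
  fix C assume "cycle C"
  then obtain u where u: "awalk u C u" unfolding cycle_def by blast
  then obtain i where i: "i < length vs" "u = vs ! i"
    using vs(2) by (metis awalk_hd_in_verts in_set_conv_nth)
  let ?n = "length vs" and ?k = "length C"
  let ?A = "gain_adj_matrix D \<phi> vs ^\<^sub>m ?k" and ?R = "real_adj_matrix vs ^\<^sub>m ?k"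
  have carr: "?A \<in> carrier_mat ?n ?n" "?R \<in> carrier_mat ?n ?n"
    using gain_adj_matrix_carrier real_adj_matrix_carrier by auto
  have "adj_matrix D vs ^\<^sub>m ?k = map_mat of_real ?R"
    by (simp add: adj_matrix_eq_of_real of_real_hom.mat_hom_pow[OF real_adj_matrix_carrier])
  then have "mat_trace ?A = mat_trace (map_mat of_real ?R)"
    using cospectral_imp_mat_trace_pow_eq[OF gain_adj_matrix_carrier _ cosp, of ?k]
    by (simp add: adj_matrix_def)
  then have "(\<Sum>i<?n. ?A $$ (i, i)) = (\<Sum>i<?n. of_real (?R $$ (i, i)))"
    using carr by (simp add: mat_trace_def carrier_matD[OF gain_adj_matrix_carrier]
        carrier_matD[OF real_adj_matrix_carrier])
  moreover have "cmod (?A $$ (j, j)) \<le> ?R $$ (j, j)" if "j < ?n" for j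
    using norm_pow_mat_le[OF gain_adj_matrix_carrier real_adj_matrix_carrier
        norm_gain_adj_matrix_le] that by blast
  \<comment> \<open>Equal traces with dominated diagonal entries force equality in every diagonal
    entry.\<close>
  ultimately have "?A $$ (i, i) = of_real (?R $$ (i, i))"
    using complex_eq_of_real_if_sum_eq[of "{..<?n}" "\<lambda>i. ?A $$ (i, i)" "\<lambda>i. ?R $$ (i, i)" i] i
    by auto
  \<comment> \<open>With \<open>N\<close> for the diagonal entry of \<open>?R\<close>, taking out
    the walk \<open>C\<close> gives a modulus of at most \<open>N - 1\<close>. Since the real part
    \<open>N - Re (gain \<phi> C)\<close> is no larger, \<open>Re (gain \<phi> C)\<close> is at
    least 1, which at modulus 1 leaves only the value 1.\<close>
  then have "cmod (of_real (?R $$ (i, i)) - gain \<phi> C) \<le> ?R $$ (i, i) - 1"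
    using norm_gain_adj_matrix_pow_diff_le[OF vs, of i C i] u i by simp
  then have "1 \<le> Re (gain \<phi> C)"
    using complex_Re_le_cmod[of "of_real (?R $$ (i, i)) - gain \<phi> C"] by simp
  then show "gain \<phi> C = 1"
    using cmod_gain_awalk[OF u] complex_Re_le_cmod[of "gain \<phi> C"] cmod_power2[of "gain \<phi> C"]
    by (simp add: complex_eq_iff)
qed

end

theorem theorem2p7:
  fixes D :: "'a pair_pre_digraph" and \<phi> :: "'a \<times> 'a \<Rightarrow> complex" and vs :: "'a list"
  assumes "gain_digraph D \<phi>"
    and "strongly_connected (with_proj D)"
    and "distinct vs" and "set vs = pverts D"
  shows "(cycle_balanced D \<phi> \<longleftrightarrow> switching_equivalent D \<phi> (\<lambda>_. 1)) \<and>
         (switching_equivalent D \<phi> (\<lambda>_. 1) \<longleftrightarrow> (\<exists>\<psi>. potential_function D \<phi> \<psi>)) \<and>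
         (switching_equivalent D \<phi> (\<lambda>_. 1) \<longleftrightarrow>
            cospectral (gain_adj_matrix D \<phi> vs) (adj_matrix D vs))"
proof -
  interpret gain_digraph D \<phi> by fact
  show ?thesis
    \<comment> \<open>The implications close up as potential to cospectral to cycle balanced to
      potential; strong connectivity enters in the last one.\<close>
    using switching_equivalent_one_iff_potential potential_imp_cycle_balanced
      cycle_balanced_imp_potential[OF _ assms(2)] potential_imp_cospectral
      cospectral_imp_cycle_balanced[OF assms(3,4)] assms(4)
    by (metis subset_refl)
qed

end
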